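(* The sesquiunital sesquialgebra $(A,\epsilon,\Delta)$ over $\mathbb{C}$ defined in the context does not admit a hopfish antipode. That is, there is no left $A\otimes A$-module $S$ such that both: (1) the dual module $S^*=\mathrm{Hom}_{\mathbb{C}}(S,\mathbb{C})$ is isomorphic, as a right $A\otimes A$-module, to $\mathrm{Hom}_A(\epsilon,\Delta)$; and (2) $S$ is free of rank one as a left module over $A=A\otimes\mathbb{C}$ (the first tensor factor of $A\otimes A$).
   Context: All tensor products without subscript are over $\mathbb{C}$. Fix $\lambda\in\mathbb{R}$ with $\lambda/2\pi$ irrational. The algebra $A$: the unital associative $\mathbb{C}$-algebra with basis $\{a_{n,l} : n,l\in\mathbb{Z}\}$ and product $a_{n_1,l_1}a_{n_2,l_2}=e^{i\lambda n_1 l_2}a_{n_1+n_2,\,l_1+l_2}$; its unit is $a_{0,0}$. The $(A\otimes A,A)$-bimodule $\Delta$ (coproduct) has $\mathbb{C}$-basis $\{d_{n_1,n_2,l}: n_1,n_2,l\in\mathbb{Z}\}$ with right action $$d_{n_1,n_2,l}\cdot a_{m,j}=e^{i\lambda m(l-j)}\,d_{n_1+m,\,n_2+m,\,l-j}$$ and left action $$(a_{m_1,j_1}\otimes a_{m_2,j_2})\cdot d_{n_1,n_2,l}=e^{-i\lambda[(n_1+m_1)j_1+(n_2+m_2)j_2]}\,d_{n_1+m_1,\,n_2+m_2,\,l-j_1-j_2}.$$ The right $A$-module $\epsilon$ (counit) has $\mathbb{C}$-basis $\{e_l: l\in\mathbb{Z}\}$ with $e_l\cdot a_{m,j}=e^{i\lambda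 m(l-j)}e_{l-j}$. $\mathrm{Hom}_A(\epsilon,\Delta)$ denotes the space of right $A$-linear maps $\zeta:\Delta\to\epsilon$ (from $\Delta$ to $\epsilon$), a right $A\otimes A$-module by $(\zeta\cdot(a\otimes b))(d):=\zeta((a\otimes b)\cdot d)$. The algebraic dual $S^*$ of a left $A\otimes A$-module $S$ is a right $A\otimes A$-module by $(f\cdot x)(s):=f(x\cdot s)$. A preantipode for $(A,\epsilon,\Delta)$ is a left $A\otimes A$-module $S$ together with an isomorphism of right $A\otimes A$-modules $S^*\cong\mathrm{Hom}_A(\epsilon,\Delta)$; it is a (hopfish) antipode if in addition $S$, considered as an $(A,A^{\mathrm{op}})$-bimodule, is a free left $A$-module of rank 1. *)

theory Defs
  imports Complex_Main "HOL-Library.Poly_Mapping" "HOL-Algebra.Module"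
begin

section \<open>Complex vector spaces with a distinguished basis\<close>

text \<open>
  The complex vector space with basis \<open>'i\<close> is the type \<open>'i \<Rightarrow>\<^sub>0 complex\<close> of finitely supported
  functions; the ring multiplication that this type carries for monoids \<open>'i\<close> is never used.
\<close>

definition cscale :: "complex \<Rightarrow> ('i \<Rightarrow>\<^sub>0 complex) \<Rightarrow> ('i \<Rightarrow>\<^sub>0 complex)" where
  "cscale c x = Poly_Mapping.map ((*) c) x"

abbreviation basis_vec :: "'i \<Rightarrow> ('i \<Rightarrow>\<^sub>0 complex)" where
  "basis_vec i \<equiv> Poly_Mapping.single i 1"

definition bilin_ext ::
  "('i \<Rightarrow> 'j \<Rightarrow> ('k \<Rightarrow>\<^sub>0 complex)) \<Rightarrow> ('i \<Rightarrow>\<^sub>0 complex) \<Rightarrow> ('j \<Rightarrow>\<^sub>0 complex) \<Rightarrow> ('k \<Rightarrow>\<^sub>0 complex)"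
  where "bilin_ext f x y =
    (\<Sum>i\<in>Poly_Mapping.keys x. \<Sum>j\<in>Poly_Mapping.keys y.
       cscale (Poly_Mapping.lookup x i * Poly_Mapping.lookup y j) (f i j))"

text \<open>The tensor product of the spaces with bases \<open>'i\<close> and \<open>'j\<close> is the space with basis \<open>'i \<times> 'j\<close>.\<close>

definition tensor_vec ::
  "('i \<Rightarrow>\<^sub>0 complex) \<Rightarrow> ('j \<Rightarrow>\<^sub>0 complex) \<Rightarrow> ('i \<times> 'j \<Rightarrow>\<^sub>0 complex)" where
  "tensor_vec = bilin_ext (\<lambda>i j. basis_vec (i, j))"

text \<open>
  Complex algebras are \<open>module\<close> records over \<open>complex\<close>, with \<open>smult\<close> the scalar multiplication.
  The product below is the bilinear one with \<open>(a \<otimes> b)(a' \<otimes> b') = aa' \<otimes> bb'\<close>.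
\<close>

definition tensor_algebra ::
  "(complex, 'i \<Rightarrow>\<^sub>0 complex) module \<Rightarrow> (complex, 'j \<Rightarrow>\<^sub>0 complex) module \<Rightarrow>
   (complex, 'i \<times> 'j \<Rightarrow>\<^sub>0 complex) module" where
  "tensor_algebra A B =
    \<lparr>carrier = UNIV,
     monoid.mult = bilin_ext (\<lambda>(i, j) (i', j').
       tensor_vec (basis_vec i \<otimes>\<^bsub>A\<^esub> basis_vec i') (basis_vec j \<otimes>\<^bsub>B\<^esub> basis_vec j')),
     one = tensor_vec \<one>\<^bsub>A\<^esub> \<one>\<^bsub>B\<^esub>,
     zero = 0,
     add = (+),
     smult = cscale\<rparr>"


section \<open>Modules over noncommutative rings\<close>

text \<open>
  HOL-Algebra's locale \<open>module\<close> requires a commutative ring of scalars.  As for its records \<open>module\<close>,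
  the fields \<open>mult\<close> and \<open>one\<close> of a module record are irrelevant.
\<close>

locale left_module = R?: ring R + M?: abelian_group M for R (structure) and M (structure) +
  assumes smult_closed:
      "\<lbrakk>a \<in> carrier R; x \<in> carrier M\<rbrakk> \<Longrightarrow> a \<odot>\<^bsub>M\<^esub> x \<in> carrier M"
    and smult_l_distr:
      "\<lbrakk>a \<in> carrier R; b \<in> carrier R; x \<in> carrier M\<rbrakk> \<Longrightarrow>
        (a \<oplus> b) \<odot>\<^bsub>M\<^esub> x = a \<odot>\<^bsub>M\<^esub> x \<oplus>\<^bsub>M\<^esub> b \<odot>\<^bsub>M\<^esub> x"
    and smult_r_distr:
      "\<lbrakk>a \<in> carrier R; x \<in> carrier M; y \<in> carrier M\<rbrakk> \<Longrightarrow>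
        a \<odot>\<^bsub>M\<^esub> (x \<oplus>\<^bsub>M\<^esub> y) = a \<odot>\<^bsub>M\<^esub> x \<oplus>\<^bsub>M\<^esub> a \<odot>\<^bsub>M\<^esub> y"
    and smult_assoc:
      "\<lbrakk>a \<in> carrier R; b \<in> carrier R; x \<in> carrier M\<rbrakk> \<Longrightarrow>
        (a \<otimes> b) \<odot>\<^bsub>M\<^esub> x = a \<odot>\<^bsub>M\<^esub> (b \<odot>\<^bsub>M\<^esub> x)"
    and smult_one:
      "x \<in> carrier M \<Longrightarrow> \<one> \<odot>\<^bsub>M\<^esub> x = x"

record ('a, 'm) right_module = "'m ring" +
  rsmult :: "'m \<Rightarrow> 'a \<Rightarrow> 'm" (infixl \<open>\<lhd>\<index>\<close> 70)

locale right_module = R?: ring R + M?: abelian_group M for R (structure) and M (structure) +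
  assumes rsmult_closed:
      "\<lbrakk>a \<in> carrier R; x \<in> carrier M\<rbrakk> \<Longrightarrow> x \<lhd>\<^bsub>M\<^esub> a \<in> carrier M"
    and rsmult_r_distr:
      "\<lbrakk>a \<in> carrier R; b \<in> carrier R; x \<in> carrier M\<rbrakk> \<Longrightarrow>
        x \<lhd>\<^bsub>M\<^esub> (a \<oplus> b) = x \<lhd>\<^bsub>M\<^esub> a \<oplus>\<^bsub>M\<^esub> x \<lhd>\<^bsub>M\<^esub> b"
    and rsmult_l_distr:
      "\<lbrakk>a \<in> carrier R; x \<in> carrier M; y \<in> carrier M\<rbrakk> \<Longrightarrow>
        (x \<oplus>\<^bsub>M\<^esub> y) \<lhd>\<^bsub>M\<^esub> a = x \<lhd>\<^bsub>M\<^esub> a \<oplus>\<^bsub>M\<^esub> y \<lhd>\<^bsub>M\<^esub> a"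
    and rsmult_assoc:
      "\<lbrakk>a \<in> carrier R; b \<in> carrier R; x \<in> carrier M\<rbrakk> \<Longrightarrow>
        x \<lhd>\<^bsub>M\<^esub> (a \<otimes> b) = (x \<lhd>\<^bsub>M\<^esub> a) \<lhd>\<^bsub>M\<^esub> b"
    and rsmult_one:
      "x \<in> carrier M \<Longrightarrow> x \<lhd>\<^bsub>M\<^esub> \<one> = x"

record ('b, 'a, 'm) bimodule = "('a, 'm) right_module" +
  lsmult :: "'b \<Rightarrow> 'm \<Rightarrow> 'm" (infixr \<open>\<rhd>\<index>\<close> 70)

definition right_module_hom ::
  "('a, 'r) ring_scheme \<Rightarrow> ('a, 'm, 'x) right_module_scheme \<Rightarrow>
   ('a, 'n, 'y) right_module_scheme \<Rightarrow> ('m \<Rightarrow> 'n) set" where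
  "right_module_hom R M N =
    {h \<in> carrier M \<rightarrow> carrier N.
       (\<forall>x\<in>carrier M. \<forall>y\<in>carrier M. h (x \<oplus>\<^bsub>M\<^esub> y) = h x \<oplus>\<^bsub>N\<^esub> h y) \<and>
       (\<forall>x\<in>carrier M. \<forall>a\<in>carrier R. h (x \<lhd>\<^bsub>M\<^esub> a) = h x \<lhd>\<^bsub>N\<^esub> a)}"

definition right_module_iso ::
  "('a, 'r) ring_scheme \<Rightarrow> ('a, 'm, 'x) right_module_scheme \<Rightarrow>
   ('a, 'n, 'y) right_module_scheme \<Rightarrow> ('m \<Rightarrow> 'n) set" where
  "right_module_iso R M N =
    {h \<in> right_module_hom R M N. bij_betw h (carrier M) (carrier N)}"

text \<open>A left module is free of rank one iff it has a basis consisting of a single element.\<close>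

definition free_of_rank_one :: "('a, 'r) ring_scheme \<Rightarrow> ('a, 'm, 'x) module_scheme \<Rightarrow> bool" where
  "free_of_rank_one R M \<longleftrightarrow> left_module R M \<and>
    (\<exists>b\<in>carrier M. \<forall>x\<in>carrier M. \<exists>!a. a \<in> carrier R \<and> x = a \<odot>\<^bsub>M\<^esub> b)"

text \<open>
  The algebraic dual of a left module \<open>S\<close> over a complex algebra \<open>B\<close>; the complex scalars act on \<open>S\<close>
  through the unit of \<open>B\<close>.  Functionals, and likewise the module maps in \<open>Hom_module\<close>, are taken to
  be \<open>undefined\<close> outside the carrier, so that they are determined by their values on it.
\<close>

definition dual_module ::
  "(complex, 'b) module \<Rightarrow> ('b, 's) module \<Rightarrow> ('b, 's \<Rightarrow> complex) right_module" where
  "dual_module B S =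
    \<lparr>carrier = {f \<in> carrier S \<rightarrow>\<^sub>E UNIV.
       (\<forall>s\<in>carrier S. \<forall>t\<in>carrier S. f (s \<oplus>\<^bsub>S\<^esub> t) = f s + f t) \<and>
       (\<forall>c. \<forall>s\<in>carrier S. f ((c \<odot>\<^bsub>B\<^esub> \<one>\<^bsub>B\<^esub>) \<odot>\<^bsub>S\<^esub> s) = c * f s)},
     monoid.mult = undefined,
     one = undefined,
     zero = (\<lambda>s\<in>carrier S. 0),
     add = (\<lambda>f g. \<lambda>s\<in>carrier S. f s + g s),
     rsmult = (\<lambda>f x. \<lambda>s\<in>carrier S. f (x \<odot>\<^bsub>S\<^esub> s))\<rparr>"

text \<open>The right module of right \<open>A\<close>-linear maps from the bimodule \<open>D\<close> to \<open>E\<close>.\<close>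

definition Hom_module ::
  "(complex, 'a) module \<Rightarrow> ('a, 'e) right_module \<Rightarrow> ('b, 'a, 'd) bimodule \<Rightarrow>
   ('b, 'd \<Rightarrow> 'e) right_module" where
  "Hom_module A E D =
    \<lparr>carrier = right_module_hom A D E \<inter> extensional (carrier D),
     monoid.mult = undefined,
     one = undefined,
     zero = (\<lambda>d\<in>carrier D. \<zero>\<^bsub>E\<^esub>),
     add = (\<lambda>f g. \<lambda>d\<in>carrier D. f d \<oplus>\<^bsub>E\<^esub> g d),
     rsmult = (\<lambda>f x. \<lambda>d\<in>carrier D. f (x \<rhd>\<^bsub>D\<^esub> d))\<rparr>"

text \<open>Restriction of a left \<open>A \<otimes> A\<close>-module along \<open>a \<mapsto> a \<otimes> 1\<close>.\<close>

definition first_factor_module ::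
  "(complex, 'i \<Rightarrow>\<^sub>0 complex) module \<Rightarrow> ('i \<times> 'i \<Rightarrow>\<^sub>0 complex, 's) module \<Rightarrow>
   ('i \<Rightarrow>\<^sub>0 complex, 's) module" where
  "first_factor_module A S =
    \<lparr>carrier = carrier S,
     monoid.mult = monoid.mult S,
     one = one S,
     zero = zero S,
     add = add S,
     smult = (\<lambda>a s. tensor_vec a \<one>\<^bsub>A\<^esub> \<odot>\<^bsub>S\<^esub> s)\<rparr>"


section \<open>Preantipodes and hopfish antipodes\<close>

definition preantipode ::
  "(complex, 'i \<Rightarrow>\<^sub>0 complex) module \<Rightarrow>
   ('i \<Rightarrow>\<^sub>0 complex, 'e) right_module \<Rightarrow>
   ('i \<times> 'i \<Rightarrow>\<^sub>0 complex, 'i \<Rightarrow>\<^sub>0 complex, 'd) bimodule \<Rightarrow>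
   ('i \<times> 'i \<Rightarrow>\<^sub>0 complex, 's) module \<Rightarrow> (('s \<Rightarrow> complex) \<Rightarrow> ('d \<Rightarrow> 'e)) \<Rightarrow> bool" where
  "preantipode A E D S \<phi> \<longleftrightarrow>
    left_module (tensor_algebra A A) S \<and>
    \<phi> \<in> right_module_iso (tensor_algebra A A)
          (dual_module (tensor_algebra A A) S) (Hom_module A E D)"

definition hopfish_antipode ::
  "(complex, 'i \<Rightarrow>\<^sub>0 complex) module \<Rightarrow>
   ('i \<Rightarrow>\<^sub>0 complex, 'e) right_module \<Rightarrow>
   ('i \<times> 'i \<Rightarrow>\<^sub>0 complex, 'i \<Rightarrow>\<^sub>0 complex, 'd) bimodule \<Rightarrow>
   ('i \<times> 'i \<Rightarrow>\<^sub>0 complex, 's) module \<Rightarrow> (('s \<Rightarrow> complex) \<Rightarrow> ('d \<Rightarrow> 'e)) \<Rightarrow> bool" where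
  "hopfish_antipode A E D S \<phi> \<longleftrightarrow>
    preantipode A E D S \<phi> \<and> free_of_rank_one A (first_factor_module A S)"


section \<open>The irrational rotation algebra, its counit and its coproduct\<close>

text \<open>
  The basis vector \<open>a\<^sub>n\<^sub>,\<^sub>l\<close> is \<open>basis_vec (n, l)\<close>, and likewise for \<open>e\<^sub>l\<close> and \<open>d\<^sub>n\<^sub>1\<^sub>,\<^sub>n\<^sub>2\<^sub>,\<^sub>l\<close>.
\<close>

definition rotation_algebra :: "real \<Rightarrow> (complex, int \<times> int \<Rightarrow>\<^sub>0 complex) module" where
  "rotation_algebra lam =
    \<lparr>carrier = UNIV,
     monoid.mult = bilin_ext (\<lambda>(n1, l1) (n2, l2).
       Poly_Mapping.single (n1 + n2, l1 + l2) (exp (\<i> * of_real lam * of_int (n1 * l2)))),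
     one = basis_vec (0, 0),
     zero = 0,
     add = (+),
     smult = cscale\<rparr>"

definition counit :: "real \<Rightarrow> (int \<times> int \<Rightarrow>\<^sub>0 complex, int \<Rightarrow>\<^sub>0 complex) right_module" where
  "counit lam =
    \<lparr>carrier = UNIV,
     monoid.mult = undefined,
     one = undefined,
     zero = 0,
     add = (+),
     rsmult = bilin_ext (\<lambda>l (m, j).
       Poly_Mapping.single (l - j) (exp (\<i> * of_real lam * of_int (m * (l - j)))))\<rparr>"

definition coproduct ::
  "real \<Rightarrow> ((int \<times> int) \<times> (int \<times> int) \<Rightarrow>\<^sub>0 complex, int \<times> int \<Rightarrow>\<^sub>0 complex,
            int \<times> int \<times> int \<Rightarrow>\<^sub>0 complex) bimodule" where
  "coproduct lam =
    \<lparr>carrier = UNIV,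
     monoid.mult = undefined,
     one = undefined,
     zero = 0,
     add = (+),
     rsmult = bilin_ext (\<lambda>(n1, n2, l) (m, j).
       Poly_Mapping.single (n1 + m, n2 + m, l - j)
         (exp (\<i> * of_real lam * of_int (m * (l - j))))),
     lsmult = bilin_ext (\<lambda>((m1, j1), (m2, j2)) (n1, n2, l).
       Poly_Mapping.single (n1 + m1, n2 + m2, l - j1 - j2)
         (exp (- \<i> * of_real lam * of_int ((n1 + m1) * j1 + (n2 + m2) * j2))))\<rparr>"


section \<open>Algebra and module axioms\<close>

definition clinear :: "(('i \<Rightarrow>\<^sub>0 complex) \<Rightarrow> ('k \<Rightarrow>\<^sub>0 complex)) \<Rightarrow> bool" where
  "clinear F \<longleftrightarrow> (\<forall>x y. F (x + y) = F x + F y) \<and> (\<forall>c x. F (cscale c x) = cscale c (F x))"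

lemma lookup_cscale [simp]: "Poly_Mapping.lookup (cscale c x) i = c * Poly_Mapping.lookup x i"
  by (simp add: cscale_def Poly_Mapping.map.rep_eq when_def)

lemma cscale_single [simp]: "cscale c (Poly_Mapping.single i b) = Poly_Mapping.single i (c * b)"
  by (rule poly_mapping_eqI) (simp add: lookup_single when_def)

lemma cscale_simps [simp]:
  "cscale c 0 = 0" "cscale 0 x = 0" "cscale 1 x = x" "cscale c (cscale d x) = cscale (c * d) x"
  by (rule poly_mapping_eqI; simp)+

lemma cscale_add: "cscale c (x + y) = cscale c x + cscale c y"
  "cscale (c + d) x = cscale c x + cscale d x"
  by (rule poly_mapping_eqI; simp add: lookup_add algebra_simps)+

lemma cscale_sum: "cscale c (sum f X) = (\<Sum>x\<in>X. cscale c (f x))"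
  by (rule poly_mapping_eqI) (simp add: lookup_sum sum_distrib_left)

lemma basis_expand:
  assumes "finite X" "Poly_Mapping.keys x \<subseteq> X"
  shows "x = (\<Sum>i\<in>X. cscale (Poly_Mapping.lookup x i) (basis_vec i))"
proof (rule poly_mapping_eqI)
  fix k
  have "(\<Sum>i\<in>X. Poly_Mapping.lookup x i when i = k) = Poly_Mapping.lookup x k"
  proof -
    have "(\<Sum>i\<in>X. Poly_Mapping.lookup x i when i = k)
        = (\<Sum>i\<in>X. if i = k then Poly_Mapping.lookup x k else 0)"
      by (rule sum.cong) (auto simp: when_def)
    also have "\<dots> = Poly_Mapping.lookup x k"
      using assms by (auto simp: sum.delta in_keys_iff)
    finally show ?thesis .
  qed
  then show "Poly_Mapping.lookup x k =
      Poly_Mapping.lookup (\<Sum>i\<in>X. cscale (Poly_Mapping.lookup x i) (basis_vec i)) k"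
    by (simp add: lookup_sum lookup_single)
qed

lemma clinear_sum: "clinear F \<Longrightarrow> F (sum f X) = (\<Sum>x\<in>X. F (f x))"
proof (induction X rule: infinite_finite_induct)
  case (infinite A) then show ?case
    using clinear_def[of F] by (metis cscale_simps(2) sum.infinite)
next
  case empty then show ?case
    using clinear_def[of F] by (metis cscale_simps(2) sum.empty)
next
  case (insert x F) then show ?case by (simp add: clinear_def)
qed

lemma clinear_eqI:
  assumes "clinear F" "clinear G" "\<And>i. F (basis_vec i) = G (basis_vec i)"
  shows "F x = G x"
proof -
  note e = basis_expand[OF finite_keys subset_refl, of x]
  have "H x = (\<Sum>i\<in>Poly_Mapping.keys x. cscale (Poly_Mapping.lookup x i) (H (basis_vec i)))"
    if "clinear H" for H
    by (subst e, subst clinear_sum[OF that]) (use that in \<open>simp only: clinear_def\<close>)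
  from this[OF assms(1)] this[OF assms(2)] show ?thesis by (simp only: assms(3))
qed

lemma bilin_ext_gen:
  assumes "finite X" "finite Y" "Poly_Mapping.keys x \<subseteq> X" "Poly_Mapping.keys y \<subseteq> Y"
  shows "bilin_ext f x y =
    (\<Sum>i\<in>X. \<Sum>j\<in>Y. cscale (Poly_Mapping.lookup x i * Poly_Mapping.lookup y j) (f i j))"
proof -
  have "(\<Sum>j\<in>Poly_Mapping.keys y. cscale (Poly_Mapping.lookup x i * Poly_Mapping.lookup y j) (f i j))
    = (\<Sum>j\<in>Y. cscale (Poly_Mapping.lookup x i * Poly_Mapping.lookup y j) (f i j))" for i
    using assms by (intro sum.mono_neutral_left) (auto simp: in_keys_iff)
  then show ?thesis
    unfolding bilin_ext_def
    using assms by (simp, intro sum.mono_neutral_left) (auto simp: in_keys_iff)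
qed

lemma bilin_ext_basis [simp]: "bilin_ext f (basis_vec i) (basis_vec j) = f i j"
  by (simp add: bilin_ext_def)

lemma bilin_ext_add1: "bilin_ext f (x + x') y = bilin_ext f x y + bilin_ext f x' y"
proof -
  let ?X = "Poly_Mapping.keys x \<union> Poly_Mapping.keys x' \<union> Poly_Mapping.keys (x + x')"
  show ?thesis
    by (subst (1 2 3) bilin_ext_gen[of ?X "Poly_Mapping.keys y"])
      (auto simp: lookup_add algebra_simps cscale_add sum.distrib)
qed

lemma bilin_ext_add2: "bilin_ext f x (y + y') = bilin_ext f x y + bilin_ext f x y'"
proof -
  let ?X = "Poly_Mapping.keys y \<union> Poly_Mapping.keys y' \<union> Poly_Mapping.keys (y + y')"
  show ?thesis
    by (subst (1 2 3) bilin_ext_gen[of "Poly_Mapping.keys x" ?X])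
      (auto simp: lookup_add algebra_simps cscale_add sum.distrib)
qed

lemma keys_cscale: "Poly_Mapping.keys (cscale c x) \<subseteq> Poly_Mapping.keys x"
  by (rule subsetI) (simp add: in_keys_iff)

lemma bilin_ext_scale1: "bilin_ext f (cscale c x) y = cscale c (bilin_ext f x y)"
  by (subst (1 2) bilin_ext_gen[of "Poly_Mapping.keys x" "Poly_Mapping.keys y"])
    (simp_all add: keys_cscale cscale_sum mult_ac)

lemma bilin_ext_scale2: "bilin_ext f x (cscale c y) = cscale c (bilin_ext f x y)"
  by (subst (1 2) bilin_ext_gen[of "Poly_Mapping.keys x" "Poly_Mapping.keys y"])
    (simp_all add: keys_cscale cscale_sum mult_ac)

lemmas bilin_ext_simps = bilin_ext_add1 bilin_ext_add2 bilin_ext_scale1 bilin_ext_scale2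

lemma bilin_ext_single:
  "bilin_ext f (Poly_Mapping.single i a) (Poly_Mapping.single j b) = cscale (a * b) (f i j)"
proof -
  have "bilin_ext f (cscale a (basis_vec i)) (cscale b (basis_vec j)) = cscale (a * b) (f i j)"
    by (simp only: bilin_ext_simps bilin_ext_basis cscale_simps mult.commute)
  then show ?thesis by simp
qed

lemma bilin_ext_assoc:
  assumes "\<And>i j k. bilin_ext f (g i j) (basis_vec k) = bilin_ext h (basis_vec i) (g' j k)"
  shows "bilin_ext f (bilin_ext g x y) z = bilin_ext h x (bilin_ext g' y z)"
proof (rule clinear_eqI[where F = "\<lambda>x. bilin_ext f (bilin_ext g x y) z"])
  fix i
  show "bilin_ext f (bilin_ext g (basis_vec i) y) z = bilin_ext h (basis_vec i) (bilin_ext g' y z)"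
  proof (rule clinear_eqI[where F = "\<lambda>y. bilin_ext f (bilin_ext g (basis_vec i) y) z"])
    fix j
    show "bilin_ext f (bilin_ext g (basis_vec i) (basis_vec j)) z =
      bilin_ext h (basis_vec i) (bilin_ext g' (basis_vec j) z)"
      by (rule clinear_eqI[where x = z]) (simp_all add: clinear_def bilin_ext_simps assms)
  qed (simp_all add: clinear_def bilin_ext_simps)
qed (simp_all add: clinear_def bilin_ext_simps)

lemma bilin_ext_unit1: "(\<And>j. f i j = basis_vec j) \<Longrightarrow> bilin_ext f (basis_vec i) y = y"
  by (rule clinear_eqI[where G = "\<lambda>y. y"]) (simp_all add: clinear_def bilin_ext_simps)

lemma bilin_ext_unit2: "(\<And>i. f i j = basis_vec i) \<Longrightarrow> bilin_ext f x (basis_vec j) = x"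
  by (rule clinear_eqI[where F = "\<lambda>x. bilin_ext f x (basis_vec j)" and G = "\<lambda>x. x"])
    (simp_all add: clinear_def bilin_ext_simps)

lemma abelian_group_UNIV:
  assumes "carrier M = UNIV" "zero M = (0::'a::ab_group_add)" "add M = (+)"
  shows "abelian_group M"
proof (rule abelian_groupI)
  show "\<exists>y\<in>carrier M. y \<oplus>\<^bsub>M\<^esub> x = \<zero>\<^bsub>M\<^esub>" for x
    by (rule bexI[of _ "- x"]) (simp_all add: assms)
qed (simp_all add: assms add.assoc add.commute)

lemma tensor_vec_basis: "tensor_vec (basis_vec i) (basis_vec j) = basis_vec (i, j)"
  by (simp add: tensor_vec_def)

lemma tensor_vec_single:
  "tensor_vec (Poly_Mapping.single i a) (Poly_Mapping.single j b) = Poly_Mapping.single (i, j) (a * b)"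
  by (simp add: tensor_vec_def bilin_ext_single)

lemma ring_rotation_algebra: "ring (rotation_algebra lam)"
proof (rule ringI)
  show "abelian_group (rotation_algebra lam)"
    by (rule abelian_group_UNIV) (simp_all add: rotation_algebra_def)
  show "monoid (rotation_algebra lam)"
    by (rule monoidI)
      (simp_all add: rotation_algebra_def bilin_ext_unit1 bilin_ext_unit2 split_beta,
       rule bilin_ext_assoc,
       clarsimp simp: bilin_ext_single mult_exp_exp algebra_simps)
qed (simp_all add: rotation_algebra_def bilin_ext_simps)

abbreviation rotation_tensor_square ::
  "real \<Rightarrow> (complex, (int \<times> int) \<times> (int \<times> int) \<Rightarrow>\<^sub>0 complex) module" where
  "rotation_tensor_square lam \<equiv> tensor_algebra (rotation_algebra lam) (rotation_algebra lam)"

lemma tensor_square_expand: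
  "rotation_tensor_square lam =
    \<lparr>carrier = UNIV,
     monoid.mult = bilin_ext (\<lambda>((n1, l1), (m1, j1)) ((n2, l2), (m2, j2)).
       Poly_Mapping.single ((n1 + n2, l1 + l2), (m1 + m2, j1 + j2))
         (exp (\<i> * of_real lam * of_int (n1 * l2 + m1 * j2)))),
     one = basis_vec ((0, 0), (0, 0)),
     zero = 0,
     add = (+),
     smult = cscale\<rparr>"
  unfolding tensor_algebra_def
  by (simp add: rotation_algebra_def tensor_vec_single,
      rule arg_cong[of _ _ bilin_ext], intro ext,
      clarsimp simp: tensor_vec_single mult_exp_exp ring_distribs)

lemma ring_rotation_tensor_square: "ring (rotation_tensor_square lam)"
proof (rule ringI)
  show "abelian_group (rotation_tensor_square lam)"
    by (rule abelian_group_UNIV) (simp_all add: tensor_square_expand)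
  show "monoid (rotation_tensor_square lam)"
    by (rule monoidI)
      (simp_all add: tensor_square_expand bilin_ext_unit1 bilin_ext_unit2 split_beta,
       rule bilin_ext_assoc,
       clarsimp simp: bilin_ext_single mult_exp_exp algebra_simps)
qed (simp_all add: tensor_square_expand bilin_ext_simps)

lemma tensor_vec_mult:
  "tensor_vec a b \<otimes>\<^bsub>rotation_tensor_square lam\<^esub> tensor_vec a' b' =
   tensor_vec (a \<otimes>\<^bsub>rotation_algebra lam\<^esub> a') (b \<otimes>\<^bsub>rotation_algebra lam\<^esub> b')"
proof -
  let ?M = "\<lambda>a b a' b'. tensor_vec a b \<otimes>\<^bsub>rotation_tensor_square lam\<^esub> tensor_vec a' b'"
  let ?T = "\<lambda>a b a' b'.
    tensor_vec (a \<otimes>\<^bsub>rotation_algebra lam\<^esub> a') (b \<otimes>\<^bsub>rotation_algebra lam\<^esub> b')"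
  note lin = clinear_def bilin_ext_simps tensor_vec_def tensor_algebra_def rotation_algebra_def
  have "?M (basis_vec i) (basis_vec j) (basis_vec i') (basis_vec j') =
      ?T (basis_vec i) (basis_vec j) (basis_vec i') (basis_vec j')" for i j i' j'
    by (simp add: tensor_algebra_def tensor_vec_basis)
  then have "?M (basis_vec i) (basis_vec j) (basis_vec i') b' =
      ?T (basis_vec i) (basis_vec j) (basis_vec i') b'" for i j i'
    by (rule clinear_eqI[rotated 2]) (simp_all add: lin)
  then have "?M (basis_vec i) (basis_vec j) a' b' = ?T (basis_vec i) (basis_vec j) a' b'" for i j
    by (rule clinear_eqI[where F = "\<lambda>a'. ?M (basis_vec i) (basis_vec j) a' b'"
          and G = "\<lambda>a'. ?T (basis_vec i) (basis_vec j) a' b'", rotated 2]) (simp_all add: lin)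
  then have "?M (basis_vec i) b a' b' = ?T (basis_vec i) b a' b'" for i
    by (rule clinear_eqI[where F = "\<lambda>b. ?M (basis_vec i) b a' b'"
          and G = "\<lambda>b. ?T (basis_vec i) b a' b'", rotated 2]) (simp_all add: lin)
  then show ?thesis
    by (rule clinear_eqI[where F = "\<lambda>a. ?M a b a' b'"
          and G = "\<lambda>a. ?T a b a' b'", rotated 2]) (simp_all add: lin)
qed

lemma right_module_counit: "right_module (rotation_algebra lam) (counit lam)"
proof (intro right_module.intro ring_rotation_algebra right_module_axioms.intro)
  show "abelian_group (counit lam)"
    by (rule abelian_group_UNIV) (simp_all add: counit_def)
  show "x \<lhd>\<^bsub>counit lam\<^esub> (a \<otimes>\<^bsub>rotation_algebra lam\<^esub> b) =
      (x \<lhd>\<^bsub>counit lam\<^esub> a) \<lhd>\<^bsub>counit lam\<^esub> b" for x a b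
    by (simp add: counit_def rotation_algebra_def split_beta,
        rule bilin_ext_assoc[symmetric],
        clarsimp simp: bilin_ext_single mult_exp_exp algebra_simps)
qed (simp_all add: counit_def rotation_algebra_def bilin_ext_simps bilin_ext_unit2)

lemma right_module_coproduct: "right_module (rotation_algebra lam) (coproduct lam)"
proof (intro right_module.intro ring_rotation_algebra right_module_axioms.intro)
  show "abelian_group (coproduct lam)"
    by (rule abelian_group_UNIV) (simp_all add: coproduct_def)
  show "x \<lhd>\<^bsub>coproduct lam\<^esub> (a \<otimes>\<^bsub>rotation_algebra lam\<^esub> b) =
      (x \<lhd>\<^bsub>coproduct lam\<^esub> a) \<lhd>\<^bsub>coproduct lam\<^esub> b" for x a b
    by (simp add: coproduct_def rotation_algebra_def split_beta,
        rule bilin_ext_assoc[symmetric],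
        clarsimp simp: bilin_ext_single mult_exp_exp algebra_simps)
qed (simp_all add: coproduct_def rotation_algebra_def bilin_ext_simps bilin_ext_unit2 split_beta)

lemma left_module_coproduct:
  "left_module (rotation_tensor_square lam)
    \<lparr>carrier = UNIV, monoid.mult = undefined, one = undefined, zero = 0, add = (+),
     smult = lsmult (coproduct lam)\<rparr>" (is "left_module _ ?D")
proof (intro left_module.intro ring_rotation_tensor_square left_module_axioms.intro)
  show "abelian_group ?D"
    by (rule abelian_group_UNIV) simp_all
  show "(a \<otimes>\<^bsub>rotation_tensor_square lam\<^esub> b) \<odot>\<^bsub>?D\<^esub> x = a \<odot>\<^bsub>?D\<^esub> (b \<odot>\<^bsub>?D\<^esub> x)" for a b x
    by (simp add: coproduct_def tensor_square_expand split_beta,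
        rule bilin_ext_assoc,
        clarsimp simp: bilin_ext_single mult_exp_exp algebra_simps)
qed (simp_all add: coproduct_def tensor_square_expand bilin_ext_simps bilin_ext_unit1 split_beta)

lemma coproduct_actions_commute:
  "(x \<rhd>\<^bsub>coproduct lam\<^esub> d) \<lhd>\<^bsub>coproduct lam\<^esub> a = x \<rhd>\<^bsub>coproduct lam\<^esub> (d \<lhd>\<^bsub>coproduct lam\<^esub> a)"
  by (simp add: coproduct_def split_beta,
      rule bilin_ext_assoc,
      clarsimp simp: bilin_ext_single mult_exp_exp algebra_simps)

end

theory Submission
  imports Defs "HOL-Library.Function_Algebras"
begin

text \<open>
  Let \<open>W = a\<^sub>0\<^sub>,\<^sub>1 \<otimes> a\<^sub>0\<^sub>,\<^sub>-\<^sub>1\<close>, \<open>P = a\<^sub>1\<^sub>,\<^sub>0 \<otimes> a\<^sub>1\<^sub>,\<^sub>0\<close> and \<open>q = exp (i\<lambda>)\<close>.  A map in \<open>Hom\<^sub>A(\<epsilon>, \<Delta>)\<close> fixed by \<open>W\<close>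
  vanishes on all \<open>d\<^sub>n\<^sub>1\<^sub>,\<^sub>n\<^sub>2\<^sub>,\<^sub>l\<close> with \<open>n\<^sub>1 \<noteq> n\<^sub>2\<close> and is determined by its value at \<open>d\<^sub>0\<^sub>,\<^sub>0\<^sub>,\<^sub>0\<close>, so the
  \<open>W\<close>-invariants form a copy of \<open>\<epsilon>\<close>, on which \<open>P\<close> is diagonal with distinct eigenvalues \<open>q\<^sup>l\<close>.
  The \<open>W\<close>-invariants of \<open>S\<^sup>*\<close>, however, are the dual of \<open>S / (W - 1) S\<close>, and a dual space never has
  countably infinite dimension.  Concretely, if the \<open>f\<^sub>l \<in> S\<^sup>*\<close> correspond to the eigenvectors of \<open>P\<close>
  and \<open>v\<^sub>n\<close> lies in the image of the product of all \<open>P - q\<^sup>j\<close> with \<open>\<bar>j\<bar> < n\<close>, with \<open>f\<^sub>n(v\<^sub>n) \<noteq> 0\<close>, then the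
  sequences \<open>(f\<^sub>l(v\<^sub>n))\<^sub>l\<close> are triangular, so some invariant functional is \<open>1\<close> on every \<open>v\<^sub>n\<close>; but every
  invariant functional is killed by such a product once \<open>n\<close> is large.  In particular there is not even
  a preantipode.
\<close>

section \<open>Irrationality and the powers of \<open>q\<close>\<close>

lemma exp_rotation_eq_1:
  assumes "lam / (2 * pi) \<notin> \<rat>" "exp (\<i> * of_real lam * of_int k) = (1::complex)"
  shows "k = 0"
proof (rule ccontr)
  assume k: "k \<noteq> 0"
  have "exp (\<i> * of_real lam * of_int k) = cis (lam * of_int k)"
    by (simp add: cis_conv_exp mult.assoc)
  with assms(2) have "cos (lam * of_int k) = 1"
    by (metis cis.simps(1) one_complex.simps(1))
  then obtain n :: int where "lam * of_int k = of_int n * 2 * pi"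
    by (auto simp: cos_one_2pi_int)
  with k have "lam / (2 * pi) = of_int n / of_int k"
    by (simp add: field_simps)
  with assms(1) show False
    by simp
qed

lemma exp_rotation_inj:
  assumes "lam / (2 * pi) \<notin> \<rat>"
    "exp (\<i> * of_real lam * of_int k) = (exp (\<i> * of_real lam * of_int l) :: complex)"
  shows "k = l"
proof -
  have "exp (\<i> * of_real lam * of_int (k - l)) = (1::complex)"
    using assms(2) by (simp add: right_diff_distrib exp_diff)
  from exp_rotation_eq_1[OF assms(1) this] show ?thesis
    by simp
qed

section \<open>Linear functionals on sequence spaces\<close>

text \<open>Evaluating a vanishing combination at \<open>p n\<close> for successive \<open>n\<close>
  kills its coefficients one by one: later terms vanish by \<open>above\<close>, earlier ones by
  induction. The family is thus independent, and the value 1 on it extends linearly to all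
  functions.\<close>

lemma functional_on_triangular_family:
  fixes u :: "nat \<Rightarrow> 'i \<Rightarrow> complex" and p :: "nat \<Rightarrow> 'i"
  assumes diag: "\<And>n. u n (p n) \<noteq> 0" and above: "\<And>m n. n < m \<Longrightarrow> u m (p n) = 0"
  obtains h :: "('i \<Rightarrow> complex) \<Rightarrow> complex"
  where "\<And>x y. h (\<lambda>i. x i + y i) = h x + h y" "\<And>c x. h (\<lambda>i. c * x i) = c * h x"
    "\<And>n. h (u n) = 1"
proof -
  define sc :: "complex \<Rightarrow> ('i \<Rightarrow> complex) \<Rightarrow> ('i \<Rightarrow> complex)" where "sc = (\<lambda>c x i. c * x i)"
  interpret vector_space_pair sc "(*) :: complex \<Rightarrow> complex \<Rightarrow> complex"
    by unfold_locales (auto simp: sc_def fun_eq_iff algebra_simps)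
  \<comment> \<open>Injectivity allows a sum over a finite subset of \<open>range u\<close> to be
    reindexed by natural numbers.\<close>
  have "u m \<noteq> u n" if "n < m" for m n
    using diag[of n] above[OF that] by metis
  then have inj: "inj u"
    by (metis injI linorder_neqE_nat)
  have "vs1.independent (range u)"
    unfolding vs1.independent_explicit_finite_subsets
  proof (intro allI impI)
    fix T c
    assume "T \<subseteq> range u" "finite T" and sum0: "(\<Sum>v\<in>T. sc (c v) v) = 0"
    then obtain N where N: "finite N" "T = u ` N"
      by (metis finite_subset_image)
    have "(\<Sum>v\<in>X. sc (c v) v) i = (\<Sum>v\<in>X. c v * v i)" for X i
      by (induction X rule: infinite_finite_induct) (simp_all add: sc_def)
    from this[of T] have zero: "(\<Sum>n\<in>N. c (u n) * u n i) = 0" for i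
      using sum0 N(2) by (simp add: sum.reindex inj_on_subset[OF inj])
    have "c (u n) = 0" if "n \<in> N" for n
      using that
    proof (induction n rule: less_induct)
      case (less n)
      have "c (u m) * u m (p n) = 0" if "m \<in> N - {n}" for m
        using that less.IH[of m] above[of n m] by (cases "m < n") auto
      then have "(\<Sum>m\<in>N - {n}. c (u m) * u m (p n)) = 0"
        by (intro sum.neutral) blast
      then have "(\<Sum>m\<in>N. c (u m) * u m (p n)) = c (u n) * u n (p n)"
        using N(1) less.prems by (simp add: sum.remove)
      with zero[of "p n"] diag[of n] show ?case
        by simp
    qed
    with N(2) show "\<forall>v\<in>T. c v = 0"
      by blast
  qed
  from linear_independent_extend[OF this, of "\<lambda>_. 1"] obtain h
    where h: "Vector_Spaces.linear sc (*) h" "\<And>n. h (u n) = 1"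
    by blast
  show ?thesis
  proof (rule that)
    show "h (\<lambda>i. x i + y i) = h x + h y" for x y
      using Vector_Spaces.linear.axioms(3)[OF h(1)] linear_add[OF h(1), of x y] by (simp add: plus_fun_def)
    show "h (\<lambda>i. c * x i) = c * h x" for c x
      using linear_scale[OF h(1), of c x] by (simp add: sc_def)
  qed (rule h(2))
qed

section \<open>The actions of \<open>W\<close> and \<open>P\<close> on the Hom space\<close>

text \<open>Complex scalars enter only as multiples of the units; this is how complex linearity is
  recovered from linearity over the algebra.\<close>

lemma scalar_action:
  "x \<lhd>\<^bsub>counit lam\<^esub> Poly_Mapping.single (0, 0) c = cscale c x"
  "d \<lhd>\<^bsub>coproduct lam\<^esub> Poly_Mapping.single (0, 0) c = cscale c d"
  "Poly_Mapping.single ((0, 0), (0, 0)) c \<rhd>\<^bsub>coproduct lam\<^esub> d = cscale c d"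
proof -
  have single: "Poly_Mapping.single i c = cscale c (basis_vec i)" for i :: 'i
    by simp
  show "x \<lhd>\<^bsub>counit lam\<^esub> Poly_Mapping.single (0, 0) c = cscale c x"
    unfolding single by (simp add: counit_def bilin_ext_simps bilin_ext_unit2 del: cscale_single)
  show "d \<lhd>\<^bsub>coproduct lam\<^esub> Poly_Mapping.single (0, 0) c = cscale c d"
    unfolding single
    by (simp add: coproduct_def bilin_ext_simps bilin_ext_unit2 split_beta del: cscale_single)
  show "Poly_Mapping.single ((0, 0), (0, 0)) c \<rhd>\<^bsub>coproduct lam\<^esub> d = cscale c d"
    unfolding single
    by (simp add: coproduct_def bilin_ext_simps bilin_ext_unit1 split_beta del: cscale_single)
qed

abbreviation hom_space where
  "hom_space lam \<equiv> right_module_hom (rotation_algebra lam) (coproduct lam) (counit lam)"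

lemma hom_space_rsmult:
  "\<zeta> \<in> hom_space lam \<Longrightarrow> \<zeta> (d \<lhd>\<^bsub>coproduct lam\<^esub> a) = \<zeta> d \<lhd>\<^bsub>counit lam\<^esub> a"
  by (simp add: right_module_hom_def coproduct_def rotation_algebra_def)

lemma clinear_hom_space:
  assumes "\<zeta> \<in> hom_space lam"
  shows "clinear \<zeta>"
  unfolding clinear_def
proof (intro conjI allI)
  show "\<zeta> (x + y) = \<zeta> x + \<zeta> y" for x y
    using assms by (simp add: right_module_hom_def coproduct_def counit_def)
  show "\<zeta> (cscale c x) = cscale c (\<zeta> x)" for c x
    using hom_space_rsmult[OF assms, of x "Poly_Mapping.single (0, 0) c"]
    by (simp add: scalar_action)
qed

text \<open>\<open>W\<close> and \<open>P - c\<close>.\<close>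

definition diagonal_elt :: "(int \<times> int) \<times> (int \<times> int) \<Rightarrow>\<^sub>0 complex" where
  "diagonal_elt = basis_vec ((0, 1), (0, -1))"

definition shifted_elt :: "complex \<Rightarrow> (int \<times> int) \<times> (int \<times> int) \<Rightarrow>\<^sub>0 complex" where
  "shifted_elt c = basis_vec ((1, 0), (1, 0)) + Poly_Mapping.single ((0, 0), (0, 0)) (- c)"

lemma diagonal_elt_coproduct:
  "diagonal_elt \<rhd>\<^bsub>coproduct lam\<^esub> basis_vec (n1, n2, l) =
    Poly_Mapping.single (n1, n2, l) (exp (\<i> * of_real lam * of_int (n2 - n1)))"
  by (simp add: diagonal_elt_def coproduct_def algebra_simps)

lemma shifted_elt_coproduct:
  "shifted_elt c \<rhd>\<^bsub>coproduct lam\<^esub> basis_vec (n1, n2, l) =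
    basis_vec (n1 + 1, n2 + 1, l) - cscale c (basis_vec (n1, n2, l))"
proof -
  have "shifted_elt c \<rhd>\<^bsub>coproduct lam\<^esub> d = basis_vec ((1, 0), (1, 0)) \<rhd>\<^bsub>coproduct lam\<^esub> d +
      Poly_Mapping.single ((0, 0), (0, 0)) (- c) \<rhd>\<^bsub>coproduct lam\<^esub> d" for d
    by (simp add: shifted_elt_def coproduct_def bilin_ext_add1)
  then show ?thesis
    by (simp only: scalar_action)
      (simp add: coproduct_def single_uminus)
qed

lemma lookup_counit_shift:
  "Poly_Mapping.lookup (x \<lhd>\<^bsub>counit lam\<^esub> basis_vec (1, 0)) i =
    exp (\<i> * of_real lam * of_int i) * Poly_Mapping.lookup x i"
  by (simp add: counit_def bilin_ext_def lookup_sum lookup_single when_def in_keys_iff)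

lemma bilin_ext_zero [simp]: "bilin_ext f 0 y = 0" "bilin_ext f x 0 = 0"
  by (simp_all add: bilin_ext_def)

section \<open>Maps invariant under \<open>W\<close>\<close>

text \<open>\<open>W\<close> multiplies \<open>d_n1,n2,l\<close> by \<open>q^(n2 - n1)\<close>,
  which is not 1 off the diagonal, so invariance forces the value 0 there; the diagonal basis
  vectors all lie in the right submodule generated by \<open>d_0,0,0\<close>.\<close>

lemma diagonal_hom_eq_0:
  assumes irr: "lam / (2 * pi) \<notin> \<rat>" and hom: "\<zeta> \<in> hom_space lam"
    and inv: "\<And>d. \<zeta> (diagonal_elt \<rhd>\<^bsub>coproduct lam\<^esub> d) = \<zeta> d"
    and zero: "\<zeta> (basis_vec (0, 0, 0)) = 0"
  shows "\<zeta> d = 0"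
proof -
  note lin = clinear_hom_space[OF hom]
  have scale: "\<zeta> (Poly_Mapping.single b c) = cscale c (\<zeta> (basis_vec b))" for b c
    using lin by (metis clinear_def cscale_single mult.right_neutral)
  have "\<zeta> (basis_vec (n1, n2, l)) = 0" for n1 n2 l
  proof (cases "n1 = n2")
    case True
    \<comment> \<open>Acting on \<open>d_0,0,0\<close> by \<open>a_n1,-l\<close> produces the phase
      \<open>q^(n1 l)\<close>, which the coefficient cancels.\<close>
    define a :: "int \<times> int \<Rightarrow>\<^sub>0 complex" where
      "a = Poly_Mapping.single (n1, - l) (exp (- (\<i> * of_real lam * of_int (n1 * l))))"
    have "basis_vec (n1, n2, l) = basis_vec (0, 0, 0) \<lhd>\<^bsub>coproduct lam\<^esub> a"
      using True by (simp add: a_def coproduct_def bilin_ext_single mult_exp_exp)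
    also have "\<zeta> \<dots> = 0 \<lhd>\<^bsub>counit lam\<^esub> a"
      by (simp only: hom_space_rsmult[OF hom] zero)
    also have "\<dots> = 0"
      by (simp add: counit_def)
    finally show ?thesis .
  next
    case False
    have "exp (\<i> * of_real lam * of_int (n2 - n1)) \<noteq> (1::complex)"
      using exp_rotation_eq_1[OF irr, of "n2 - n1"] False by auto
    moreover have "cscale (exp (\<i> * of_real lam * of_int (n2 - n1))) (\<zeta> (basis_vec (n1, n2, l))) =
        \<zeta> (basis_vec (n1, n2, l))"
      using inv[of "basis_vec (n1, n2, l)"] unfolding diagonal_elt_coproduct
      by (rule trans[OF scale[symmetric]])
    ultimately have "Poly_Mapping.lookup (\<zeta> (basis_vec (n1, n2, l))) i = 0" for i
      by (metis lookup_cscale mult_cancel_right1)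
    then show ?thesis
      by (simp add: poly_mapping_eqI)
  qed
  then have "\<zeta> (basis_vec b) = 0" for b
    by (cases b) auto
  then show ?thesis
    using clinear_eqI[OF lin, of "\<lambda>_. 0"] by (simp add: clinear_def)
qed

text \<open>The element of \<open>Hom\<close> supported on \<open>n\<^sub>1 = n\<^sub>2\<close> whose value at \<open>d\<^sub>0\<^sub>,\<^sub>0\<^sub>,\<^sub>0\<close> is \<open>w\<close>.\<close>

definition diagonal_hom ::
  "real \<Rightarrow> (int \<Rightarrow>\<^sub>0 complex) \<Rightarrow> (int \<times> int \<times> int \<Rightarrow>\<^sub>0 complex) \<Rightarrow> (int \<Rightarrow>\<^sub>0 complex)" where
  "diagonal_hom lam = bilin_ext (\<lambda>l (n1, n2, m).
     if n1 = n2 then Poly_Mapping.single (l + m) (exp (\<i> * of_real lam * of_int (n1 * l))) else 0)"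

text \<open>The right action preserves \<open>n1 - n2\<close>, so vanishing off the diagonal is
  compatible with it. On the diagonal, \<open>a_n,-m\<close> takes \<open>d_0,0,0\<close> to
  \<open>q^(n m) d_n,n,m\<close> and \<open>e_l\<close> to \<open>q^(n (l + m)) e_(l + m)\<close>;
  the quotient of the phases is the factor \<open>q^(n l)\<close>.\<close>

lemma diagonal_hom_in_hom_space: "diagonal_hom lam w \<in> hom_space lam"
proof -
  have "diagonal_hom lam w (d \<lhd>\<^bsub>coproduct lam\<^esub> a) = diagonal_hom lam w d \<lhd>\<^bsub>counit lam\<^esub> a" for d a
    unfolding diagonal_hom_def coproduct_def counit_def
    by (simp, rule bilin_ext_assoc[symmetric])
      (clarsimp simp: bilin_ext_single mult_exp_exp algebra_simps)
  then show ?thesis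
    by (simp add: right_module_hom_def coproduct_def counit_def diagonal_hom_def bilin_ext_add2)
qed

lemma clinear_coproduct_action:
  assumes "\<zeta> \<in> hom_space lam"
  shows "clinear (\<lambda>d. \<zeta> (x \<rhd>\<^bsub>coproduct lam\<^esub> d))"
  using clinear_hom_space[OF assms] by (simp add: clinear_def coproduct_def bilin_ext_simps)

lemma diagonal_hom_diagonal_elt:
  "diagonal_hom lam w (diagonal_elt \<rhd>\<^bsub>coproduct lam\<^esub> d) = diagonal_hom lam w d"
proof -
  have "diagonal_hom lam (basis_vec l) (diagonal_elt \<rhd>\<^bsub>coproduct lam\<^esub> basis_vec b) =
      diagonal_hom lam (basis_vec l) (basis_vec b)" for l b
    by (cases b) (simp add: diagonal_elt_coproduct diagonal_hom_def bilin_ext_single)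
  then have "diagonal_hom lam w (diagonal_elt \<rhd>\<^bsub>coproduct lam\<^esub> basis_vec b) =
      diagonal_hom lam w (basis_vec b)" for b
    by (rule clinear_eqI[rotated 2]) (simp_all add: clinear_def diagonal_hom_def bilin_ext_simps)
  then show ?thesis
    by (rule clinear_eqI[rotated 2])
      (rule clinear_coproduct_action clinear_hom_space, rule diagonal_hom_in_hom_space)+
qed

text \<open>The value at \<open>d_n,n,m\<close> is \<open>q^(n l) e_(l + m)\<close>, so raising
  \<open>n\<close> by one, as \<open>P\<close> does, multiplies it by \<open>q^l\<close>.\<close>

lemma diagonal_hom_shifted_elt:
  "diagonal_hom lam (basis_vec l)
    (shifted_elt (exp (\<i> * of_real lam * of_int l)) \<rhd>\<^bsub>coproduct lam\<^esub> d) = 0"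
proof (rule clinear_eqI[where x = d and G = "\<lambda>_. 0"])
  note lin = clinear_hom_space[OF diagonal_hom_in_hom_space, of lam "basis_vec l"]
  have diff: "diagonal_hom lam (basis_vec l) (x - cscale c y) =
      diagonal_hom lam (basis_vec l) x - cscale c (diagonal_hom lam (basis_vec l) y)" for x c y
    using lin unfolding clinear_def by (metis add_diff_cancel_right' diff_add_cancel)
  show "diagonal_hom lam (basis_vec l)
      (shifted_elt (exp (\<i> * of_real lam * of_int l)) \<rhd>\<^bsub>coproduct lam\<^esub> basis_vec b) = 0" for b
  proof (cases b)
    case (fields n1 n2 m)
    then show ?thesis
      by (simp only: shifted_elt_coproduct diff)
        (simp add: diagonal_hom_def mult_exp_exp algebra_simps)
  qed
  show "clinear (\<lambda>d. diagonal_hom lam (basis_vec l)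
      (shifted_elt (exp (\<i> * of_real lam * of_int l)) \<rhd>\<^bsub>coproduct lam\<^esub> d))"
    by (rule clinear_coproduct_action[OF diagonal_hom_in_hom_space])
qed (simp add: clinear_def)

section \<open>Transport between the dual of \<open>S\<close> and the Hom space\<close>

locale rotation_preantipode =
  fixes lam :: real and S (structure) and \<phi>
  assumes irr: "lam / (2 * pi) \<notin> \<rat>"
    and pre: "preantipode (rotation_algebra lam) (counit lam) (coproduct lam) S \<phi>"
begin

sublocale left_module "rotation_tensor_square lam" S
  using pre by (simp add: preantipode_def)

abbreviation scalar :: "complex \<Rightarrow> (int \<times> int) \<times> (int \<times> int) \<Rightarrow>\<^sub>0 complex" where
  "scalar c \<equiv> Poly_Mapping.single ((0, 0), (0, 0)) c"

abbreviation dual where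
  "dual \<equiv> carrier (dual_module (rotation_tensor_square lam) S)"

lemma action_closed [simp]: "s \<in> carrier S \<Longrightarrow> x \<odot> s \<in> carrier S"
  using smult_closed[of x s] by (simp add: tensor_square_expand)

lemma action_add:
  "s \<in> carrier S \<Longrightarrow> t \<in> carrier S \<Longrightarrow> x \<odot> (s \<oplus> t) = x \<odot> s \<oplus> x \<odot> t"
  using smult_r_distr[of x s t] by (simp add: tensor_square_expand)

lemma action_assoc: "s \<in> carrier S \<Longrightarrow> bilin_ext (\<lambda>((n1, l1), (m1, j1)) ((n2, l2), (m2, j2)).
       Poly_Mapping.single ((n1 + n2, l1 + l2), (m1 + m2, j1 + j2))
         (exp (\<i> * of_real lam * of_int (n1 * l2 + m1 * j2)))) x y \<odot> s = x \<odot> (y \<odot> s)"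
  using smult_assoc[of x y s] by (simp add: tensor_square_expand)

text \<open>Multiples of the unit are central; hence composing a functional with the action of
  \<open>x\<close> keeps it homogeneous.\<close>

lemma scalar_commute:
  assumes "s \<in> carrier S"
  shows "x \<odot> (scalar c \<odot> s) = scalar c \<odot> (x \<odot> s)"
proof -
  have "scalar c = cscale c (basis_vec ((0, 0), (0, 0)))"
    by simp
  then show ?thesis
    unfolding action_assoc[OF assms, symmetric]
    by (simp add: bilin_ext_simps bilin_ext_unit1 bilin_ext_unit2 split_beta del: cscale_single)
qed

lemma dual_iff:
  "f \<in> dual \<longleftrightarrow> f \<in> extensional (carrier S) \<and>
    (\<forall>s\<in>carrier S. \<forall>t\<in>carrier S. f (s \<oplus> t) = f s + f t) \<and>
    (\<forall>c. \<forall>s\<in>carrier S. f (scalar c \<odot> s) = c * f s)"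
  by (auto simp: dual_module_def tensor_square_expand PiE_def)

lemma dual_add: "f \<in> dual \<Longrightarrow> s \<in> carrier S \<Longrightarrow> t \<in> carrier S \<Longrightarrow> f (s \<oplus> t) = f s + f t"
  and dual_scalar: "f \<in> dual \<Longrightarrow> s \<in> carrier S \<Longrightarrow> f (scalar c \<odot> s) = c * f s"
  by (simp_all add: dual_iff)

lemma dual_action: "f \<in> dual \<Longrightarrow> (\<lambda>s\<in>carrier S. f (x \<odot> s)) \<in> dual"
  by (simp add: dual_iff scalar_commute action_add add.m_closed)

lemma dual_shifted_elt:
  assumes "f \<in> dual" "s \<in> carrier S"
  shows "f (shifted_elt c \<odot> s) = f (basis_vec ((1, 0), (1, 0)) \<odot> s) - c * f s"
proof -
  have "shifted_elt c \<odot> s = basis_vec ((1, 0), (1, 0)) \<odot> s \<oplus> scalar (- c) \<odot> s"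
    using smult_l_distr[of "basis_vec ((1, 0), (1, 0))" "scalar (- c)" s] assms(2)
    by (simp add: shifted_elt_def tensor_square_expand)
  with assms show ?thesis
    by (simp add: dual_add dual_scalar)
qed

lemma iso_bij: "bij_betw \<phi> dual (hom_space lam)"
  and iso_action: "f \<in> dual \<Longrightarrow>
    \<phi> (\<lambda>s\<in>carrier S. f (x \<odot> s)) = (\<lambda>d. \<phi> f (x \<rhd>\<^bsub>coproduct lam\<^esub> d))"
proof -
  let ?A = "rotation_algebra lam" and ?E = "counit lam" and ?D = "coproduct lam"
  have iso: "\<phi> \<in> right_module_iso (rotation_tensor_square lam)
      (dual_module (rotation_tensor_square lam) S) (Hom_module ?A ?E ?D)"
    using pre by (simp add: preantipode_def)
  have "carrier ?D = UNIV"
    by (simp add: coproduct_def)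
  then have "carrier (Hom_module ?A ?E ?D) = hom_space lam"
    by (simp add: Hom_module_def)
  with iso show "bij_betw \<phi> dual (hom_space lam)"
    by (simp add: right_module_iso_def)
  show "\<phi> (\<lambda>s\<in>carrier S. f (x \<odot> s)) = (\<lambda>d. \<phi> f (x \<rhd>\<^bsub>coproduct lam\<^esub> d))" if "f \<in> dual"
  proof -
    have "x \<in> carrier (rotation_tensor_square lam)"
      by (simp add: tensor_square_expand)
    with iso that have "\<phi> (rsmult (dual_module (rotation_tensor_square lam) S) f x) =
        rsmult (Hom_module ?A ?E ?D) (\<phi> f) x"
      unfolding right_module_iso_def right_module_hom_def[of "rotation_tensor_square lam"] by blast
    then show ?thesis
      using \<open>carrier ?D = UNIV\<close> by (simp add: dual_module_def Hom_module_def restrict_def)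
  qed
qed

lemma iso_hom_space: "f \<in> dual \<Longrightarrow> \<phi> f \<in> hom_space lam"
  using iso_bij by (auto simp: bij_betw_def)

text \<open>\<open>\<phi>\<close> is injective and carries translates of functionals to translates
  of maps, so equations between translates can be tested on either side.\<close>

lemma iso_action_eq_iff:
  assumes "f \<in> dual" "g \<in> dual"
  shows "(\<forall>s\<in>carrier S. f (x \<odot> s) = g (y \<odot> s)) \<longleftrightarrow>
    (\<forall>d. \<phi> f (x \<rhd>\<^bsub>coproduct lam\<^esub> d) = \<phi> g (y \<rhd>\<^bsub>coproduct lam\<^esub> d))"
proof -
  have "(\<forall>s\<in>carrier S. f (x \<odot> s) = g (y \<odot> s)) \<longleftrightarrow>
      (\<lambda>s\<in>carrier S. f (x \<odot> s)) = (\<lambda>s\<in>carrier S. g (y \<odot> s))"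
    by (auto simp: fun_eq_iff restrict_def)
  also have "\<dots> \<longleftrightarrow> \<phi> (\<lambda>s\<in>carrier S. f (x \<odot> s)) = \<phi> (\<lambda>s\<in>carrier S. g (y \<odot> s))"
    by (rule inj_on_eq_iff[OF bij_betw_imp_inj_on[OF iso_bij] dual_action dual_action, symmetric])
      (fact assms)+
  finally show ?thesis
    using assms by (simp add: iso_action fun_eq_iff)
qed

text \<open>Writing zero as the action of \<open>scalar 0\<close> makes this an instance of
  \<open>iso_action_eq_iff\<close>.\<close>

lemma dual_eq_0_iff:
  assumes "f \<in> dual"
  shows "(\<forall>s\<in>carrier S. f (x \<odot> s) = 0) \<longleftrightarrow> (\<forall>d. \<phi> f (x \<rhd>\<^bsub>coproduct lam\<^esub> d) = 0)"
proof -
  have "\<phi> f 0 = 0"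
    using clinear_hom_space[OF iso_hom_space[OF assms]] by (metis clinear_def cscale_simps(2))
  then show ?thesis
    using iso_action_eq_iff[OF assms assms, of x "scalar 0"] dual_scalar[OF assms, of _ 0]
      scalar_action(3)[of lam 0] by simp
qed

section \<open>Invariant functionals and their annihilation\<close>

definition invariant where
  "invariant f \<longleftrightarrow> f \<in> dual \<and> (\<forall>s\<in>carrier S. f (diagonal_elt \<odot> s) = f s)"

lemma invariant_iff:
  assumes "f \<in> dual"
  shows "invariant f \<longleftrightarrow> (\<forall>d. \<phi> f (diagonal_elt \<rhd>\<^bsub>coproduct lam\<^esub> d) = \<phi> f d)"
  using iso_action_eq_iff[OF assms assms, of diagonal_elt "scalar 1"] assms
  by (simp add: invariant_def dual_scalar scalar_action)

text \<open>The head of the list acts last, so a functional can absorb its factor, leaving the tail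
  for an induction.\<close>

fun annihilate :: "int list \<Rightarrow> 'a \<Rightarrow> 'a" where
  "annihilate [] s = s"
| "annihilate (j # js) s =
    shifted_elt (exp (\<i> * of_real lam * of_int j)) \<odot> annihilate js s"

lemma annihilate_closed: "s \<in> carrier S \<Longrightarrow> annihilate js s \<in> carrier S"
  by (induction js) simp_all

text \<open>In \<open>P W\<close> the two tensor factors contribute the phases \<open>q\<close> and
  \<open>q^-1\<close>, which cancel; in \<open>W P\<close> both phases are 1.\<close>

lemma diagonal_shifted_commute:
  "s \<in> carrier S \<Longrightarrow> diagonal_elt \<odot> (shifted_elt c \<odot> s) = shifted_elt c \<odot> (diagonal_elt \<odot> s)"
  unfolding action_assoc[symmetric]
  by (simp add: diagonal_elt_def shifted_elt_def bilin_ext_add1 bilin_ext_add2 bilin_ext_single)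

text \<open>Since \<open>d_1,1,0\<close> is \<open>d_0,0,0\<close> acted on by \<open>a_1,0\<close>,
  translating \<open>g\<close> by \<open>P - q^j\<close> multiplies the coefficient at
  \<open>i\<close> of its value at \<open>d_0,0,0\<close> by \<open>q^i - q^j\<close>, which removes
  the key \<open>j\<close>. Translates stay invariant, and once no key is left
  \<open>diagonal_hom_eq_0\<close> applies.\<close>

lemma annihilate_invariant:
  assumes "invariant g" "Poly_Mapping.keys (\<phi> g (basis_vec (0, 0, 0))) \<subseteq> set js" "s \<in> carrier S"
  shows "g (annihilate js s) = 0"
  using assms(1,2)
proof (induction js arbitrary: g)
  case Nil
  then have g: "g \<in> dual"
    by (simp add: invariant_def)
  have "\<phi> g d = 0" for d
    by (rule diagonal_hom_eq_0[OF irr iso_hom_space[OF g]]) (use Nil invariant_iff[OF g] in auto)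
  then have "g (scalar 1 \<odot> s) = 0"
    using dual_eq_0_iff[OF g, of "scalar 1"] assms(3) by simp
  then show ?case
    using dual_scalar[OF g assms(3), of 1] by simp
next
  case (Cons j js)
  define q where "q = (exp (\<i> * of_real lam * of_int j) :: complex)"
  define g' where "g' = (\<lambda>s\<in>carrier S. g (shifted_elt q \<odot> s))"
  have g: "g \<in> dual"
    using Cons.prems by (simp add: invariant_def)
  have "invariant g'"
    using Cons.prems(1) dual_action[OF g]
    by (simp add: invariant_def g'_def diagonal_shifted_commute[symmetric])
  moreover have "Poly_Mapping.keys (\<phi> g' (basis_vec (0, 0, 0))) \<subseteq> set js"
  proof -
    let ?w = "\<phi> g (basis_vec (0, 0, 0))"
    note lin = clinear_hom_space[OF iso_hom_space[OF g]]
    have "basis_vec (0, 0, 0) \<lhd>\<^bsub>coproduct lam\<^esub> basis_vec (1, 0) = basis_vec (1, 1, 0)"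
      by (simp add: coproduct_def)
    then have "\<phi> g (basis_vec (1, 1, 0)) = ?w \<lhd>\<^bsub>counit lam\<^esub> basis_vec (1, 0)"
      using hom_space_rsmult[OF iso_hom_space[OF g]] by metis
    moreover have "\<phi> g (x - cscale c y) = \<phi> g x - cscale c (\<phi> g y)" for x c y
      using lin unfolding clinear_def by (metis add_diff_cancel_right' diff_add_cancel)
    ultimately have "\<phi> g' (basis_vec (0, 0, 0)) = ?w \<lhd>\<^bsub>counit lam\<^esub> basis_vec (1, 0) - cscale q ?w"
      by (simp add: g'_def iso_action[OF g] shifted_elt_coproduct del: cscale_single)
    then show ?thesis
      using Cons.prems(2) by (auto simp: in_keys_iff lookup_minus lookup_counit_shift q_def)
  qed
  ultimately have "g' (annihilate js s) = 0"
    by (rule Cons.IH)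
  then show ?case
    using annihilate_closed[OF assms(3)] by (simp add: g'_def q_def)
qed

section \<open>The contradiction from a triangular family\<close>

lemma inconsistent: False
proof -
  define q :: "int \<Rightarrow> complex" where "q = (\<lambda>l. exp (\<i> * of_real lam * of_int l))"
  define f where "f l = inv_into dual \<phi> (diagonal_hom lam (basis_vec l))" for l
  have "diagonal_hom lam (basis_vec l) \<in> \<phi> ` dual" for l
    using iso_bij diagonal_hom_in_hom_space by (simp add: bij_betw_def)
  then have f: "f l \<in> dual" and \<phi>_f: "\<phi> (f l) = diagonal_hom lam (basis_vec l)" for l
    by (simp_all add: f_def inv_into_into f_inv_into_f)
  have f_inv: "f l (diagonal_elt \<odot> s) = f l s" if "s \<in> carrier S" for l s
    using invariant_iff[OF f, of l] that by (simp add: \<phi>_f diagonal_hom_diagonal_elt invariant_def)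
  have "f l (shifted_elt (q l) \<odot> s) = 0" if "s \<in> carrier S" for l s
    using dual_eq_0_iff[OF f, of l "shifted_elt (q l)"] that
    by (simp add: \<phi>_f diagonal_hom_shifted_elt q_def)
  then have f_shifted: "f l (shifted_elt c \<odot> s) = (q l - c) * f l s" if "s \<in> carrier S" for l c s
    using that by (simp add: dual_shifted_elt f algebra_simps)
  have f_annihilate: "f l (annihilate js s) = (\<Prod>j\<leftarrow>js. q l - q j) * f l s"
    if "s \<in> carrier S" for l js s
    using that
    by (induction js) (simp_all add: f_shifted annihilate_closed q_def)
  have "\<exists>s\<in>carrier S. f l s \<noteq> 0" for l
  proof (rule ccontr)
    assume "\<not> ?thesis"
    then have "\<forall>d. \<phi> (f l) (scalar 1 \<rhd>\<^bsub>coproduct lam\<^esub> d) = 0"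
      using dual_eq_0_iff[OF f, of l "scalar 1"] by simp
    then have "diagonal_hom lam (basis_vec l) (basis_vec (0, 0, 0)) = 0"
      by (simp add: \<phi>_f scalar_action)
    then have "basis_vec l = (0 :: int \<Rightarrow>\<^sub>0 complex)"
      by (simp add: diagonal_hom_def)
    then show False
      by (metis lookup_single_eq lookup_zero zero_neq_one)
  qed
  then obtain s where s: "\<And>l. s l \<in> carrier S" "\<And>l. f l (s l) \<noteq> 0"
    by metis
  \<comment> \<open>\<open>f (int n)\<close> survives on \<open>v n\<close> because
    \<open>q^n\<close> differs from every \<open>q^j\<close> with \<open>|j| < n\<close>, while
    \<open>f (int k)\<close> with \<open>k < n\<close> meets a zero factor. The range is symmetric
    because the keys to be covered at the end may be negative.\<close>
  define v where "v n = annihilate [1 - int n..int n - 1] (s (int n))" for n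
  have v: "v n \<in> carrier S" for n
    by (simp add: v_def annihilate_closed s)
  have f_v: "f l (v n) = (\<Prod>j\<leftarrow>[1 - int n..int n - 1]. q l - q j) * f l (s (int n))" for l n
    by (simp add: v_def f_annihilate s)
  have diag: "f (int n) (v n) \<noteq> 0" for n
  proof -
    have "0 \<noteq> q (int n) - q j" if "j \<in> {1 - int n..int n - 1}" for j
      using exp_rotation_inj[OF irr, of "int n" j] that by (auto simp: q_def)
    then have "0 \<notin> set (map (\<lambda>j. q (int n) - q j) [1 - int n..int n - 1])"
      unfolding set_map set_upto by blast
    then show ?thesis
      using s(2)[of "int n"] by (simp only: f_v mult_eq_0_iff prod_list_zero_iff simp_thms)
  qed
  have above: "f (int n) (v m) = 0" if "n < m" for m n
  proof -
    have "int n \<in> set [1 - int m..int m - 1]"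
      using that by simp
    then have "(\<Prod>j\<leftarrow>[1 - int m..int m - 1]. q (int n) - q j) = 0"
      unfolding prod_list_zero_iff set_map by (rule rev_image_eqI) simp
    then show ?thesis
      by (simp only: f_v mult_zero_left)
  qed
  \<comment> \<open>Row \<open>n\<close> of the triangular family is the full sequence of values at
    \<open>v n\<close>, with its pivot at the index \<open>int n\<close>.\<close>
  obtain h :: "(int \<Rightarrow> complex) \<Rightarrow> complex" where
    h_add: "\<And>x y. h (\<lambda>i. x i + y i) = h x + h y" and h_scale: "\<And>c x. h (\<lambda>i. c * x i) = c * h x"
    and h_v: "\<And>n. h (\<lambda>i. f i (v n)) = 1"
    by (rule functional_on_triangular_family[where u = "\<lambda>n i. f i (v n)", OF diag above])
      (assumption, rule that)
  \<comment> \<open>\<open>h\<close> is linear on all sequences, so \<open>g\<close> is again a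
    functional, and it inherits invariance from the \<open>f i\<close>.\<close>
  define g where "g = (\<lambda>s\<in>carrier S. h (\<lambda>i. f i s))"
  have "invariant g"
    unfolding invariant_def dual_iff
    using h_add h_scale by (simp add: g_def f_inv dual_add[OF f] dual_scalar[OF f])
  let ?K = "Poly_Mapping.keys (\<phi> g (basis_vec (0, 0, 0)))"
  \<comment> \<open>Inserting 0 covers an empty key set; \<open>Suc\<close> makes the bound on the
    keys strict.\<close>
  define n where "n = Suc (nat (Max (insert 0 (abs ` ?K))))"
  have "\<bar>k\<bar> < int n" if "k \<in> ?K" for k
  proof -
    have "\<bar>k\<bar> \<le> Max (insert 0 (abs ` ?K))"
      using that by (intro Max_ge) auto
    then show ?thesis
      by (simp add: n_def)
  qed
  then have "?K \<subseteq> set [1 - int n..int n - 1]"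
    by fastforce
  then have "g (v n) = 0"
    unfolding v_def by (rule annihilate_invariant[OF \<open>invariant g\<close> _ s(1)])
  then show False
    using h_v[of n] v[of n] by (simp add: g_def)
qed

end

theorem proposition2:
  fixes lam :: real
  assumes "lam / (2 * pi) \<notin> \<rat>"
  shows "\<not> (\<exists>(S :: ((int \<times> int) \<times> (int \<times> int) \<Rightarrow>\<^sub>0 complex, 's) module) \<phi>.
    hopfish_antipode (rotation_algebra lam) (counit lam) (coproduct lam) S \<phi>)"
proof (intro notI, elim exE)
  fix S :: "((int \<times> int) \<times> (int \<times> int) \<Rightarrow>\<^sub>0 complex, 's) module" and \<phi>
  assume "hopfish_antipode (rotation_algebra lam) (counit lam) (coproduct lam) S \<phi>"
  then have "preantipode (rotation_algebra lam) (counit lam) (coproduct lam) S \<phi>"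
    unfolding hopfish_antipode_def by (rule conjunct1)
  with assms have "rotation_preantipode lam S \<phi>"
    by (rule rotation_preantipode.intro)
  then show False
    by (rule rotation_preantipode.inconsistent)
qed

end
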